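(* Suppose $(X,d)$ is a Polish metric space whose metric covering dimension satisfies $\xi_X\le n$ (where $0\le n<\infty$), and let $\mu,\nu\in P(X)$. Then $T_\mu^n=T_\nu^n$ if and only if $\mu=\nu$.
   Context: $P(X)$ denotes the set of Borel probability measures on $X$. For a measurable $f\colon X\to\mathbb{R}$, $f_\sharp\mu(U)=\mu(f^{-1}(U))$ for Borel $U\subseteq\mathbb{R}$. For $a\in X$ let $f_a(x)=d(x,a)$. Let $f\wedge g$ denote the pointwise minimum. Let $I=[0,1]$. For $\alpha\in I^{n+1}$ and $a\in X^{n+1}$ (points not necessarily distinct), set $f_a^\alpha=\alpha_0 f_{a_0}\wedge\cdots\wedge\alpha_n f_{a_n}$ (a 1-Lipschitz function), and $\Lambda_n(X)=\{f_a^\alpha : \alpha\in I^{n+1},\ a\in X^{n+1}\}$. The $n$-distance transform $T_\mu^n\colon\Lambda_n(X)\to P(\mathbb{R})$ is $T_\mu^n(f)=f_\sharp\mu$. A closed subset $S\subseteq X$ has covering dimension by balls $\le n$ if any cover of $S$ by open sets in $X$ can be refined to a cover of $S$ by open balls of $X$ such that no sub-collection of $k$ distinct balls in the refinement has non-empty intersection if $k>n+1$. The metric covering dimension $\xi_X(S)$ is the infimum of the integers $n\ge 0$ such that $S$ has covering dimension by balls $\le n$ (and $\infty$ if there is no such $n$). One writes $\xi_X=\xi_X(X)$. *)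

theory Defs
  imports "HOL-Probability.Probability"
begin

text \<open>
  Balls count as distinct when they are distinct as point sets. The notion is intended for
  closed \<open>S\<close>; the covering sets, the balls and their centres live in the whole space.
\<close>
definition ball_covering_dim_le :: "'a::metric_space set \<Rightarrow> nat \<Rightarrow> bool" where
  "ball_covering_dim_le S n \<longleftrightarrow>
     (\<forall>\<U>. (\<forall>U\<in>\<U>. open U) \<and> S \<subseteq> \<Union>\<U> \<longrightarrow>
        (\<exists>\<B>. (\<forall>B\<in>\<B>. \<exists>x r. r > 0 \<and> B = ball x r) \<and>
             S \<subseteq> \<Union>\<B> \<and>
             (\<forall>B\<in>\<B>. \<exists>U\<in>\<U>. B \<subseteq> U) \<and>
             (\<forall>\<K>. \<K> \<subseteq> \<B> \<and> finite \<K> \<and> card \<K> > n + 1 \<longrightarrow> \<Inter>\<K> = {})))"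

text \<open>The infimum of the empty set in \<^typ>\<open>enat\<close> is \<open>\<infinity>\<close>.\<close>
definition metric_covering_dim :: "'a::metric_space set \<Rightarrow> enat" where
  "metric_covering_dim S = Inf (enat ` {n. ball_covering_dim_le S n})"

text \<open>
  Tuples indexed by \<open>0, \<dots>, n\<close> are functions on \<^typ>\<open>nat\<close> of which only the values at
  indices \<open>\<le> n\<close> matter.
\<close>
definition scaled_dist_min ::
  "nat \<Rightarrow> (nat \<Rightarrow> real) \<Rightarrow> (nat \<Rightarrow> 'a::metric_space) \<Rightarrow> 'a \<Rightarrow> real" where
  "scaled_dist_min n \<alpha> a = (\<lambda>x. Min ((\<lambda>i. \<alpha> i * dist x (a i)) ` {..n}))"

definition dist_min_funs :: "nat \<Rightarrow> ('a::metric_space \<Rightarrow> real) set" where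
  "dist_min_funs n = {scaled_dist_min n \<alpha> a | \<alpha> a. \<forall>i\<le>n. \<alpha> i \<in> {0..1}}"

text \<open>
  Restricting to \<^term>\<open>dist_min_funs n\<close> makes equality of two transforms mean agreement on
  that domain only.
\<close>
definition dist_transform ::
  "nat \<Rightarrow> 'a::metric_space measure \<Rightarrow> ('a \<Rightarrow> real) \<Rightarrow> real measure" where
  "dist_transform n \<mu> = (\<lambda>f\<in>dist_min_funs n. distr \<mu> borel f)"

lemma continuous_on_scaled_dist_min: "continuous_on UNIV (scaled_dist_min n \<alpha> a)"
proof (induction n)
  case 0
  show ?case
    by (auto simp: scaled_dist_min_def intro!: continuous_intros)
next
  case (Suc n)
  have "scaled_dist_min (Suc n) \<alpha> a =
      (\<lambda>x. min (\<alpha> (Suc n) * dist x (a (Suc n))) (scaled_dist_min n \<alpha> a x))"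
    by (simp add: scaled_dist_min_def atMost_Suc)
  with Suc show ?case
    by (auto intro!: continuous_intros)
qed

lemma dist_transform_in_prob_algebra:
  assumes "prob_space \<mu>" and "sets \<mu> = sets borel"
  shows "dist_transform n \<mu> \<in> dist_min_funs n \<rightarrow> space (prob_algebra borel)"
proof
  fix f :: "'a \<Rightarrow> real"
  assume f: "f \<in> dist_min_funs n"
  then have "f \<in> borel_measurable borel"
    by (auto simp: dist_min_funs_def
        intro: borel_measurable_continuous_onI continuous_on_scaled_dist_min)
  then have "f \<in> borel_measurable \<mu>"
    using measurable_cong_sets[OF assms(2) refl] by blast
  then show "dist_transform n \<mu> f \<in> space (prob_algebra borel)"
    using f assms(1) by (simp add: dist_transform_def space_prob_algebra prob_space.prob_space_distr)
qed

end

theory Submission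
  imports Defs
begin

text \<open>
  Only the direction from equal transforms to equal measures has content. For \<open>t > 0\<close> and radii
  \<open>r\<^sub>i \<ge> t\<close> the coefficients \<open>t / r\<^sub>i\<close> lie in \<open>[0,1]\<close>, and the set where
  \<open>min\<^sub>i (t / r\<^sub>i) d(x, a\<^sub>i) < t\<close> is the union of the balls \<open>B(a\<^sub>i, r\<^sub>i)\<close>. Hence the transform
  determines the measure of every union of at most \<open>n + 1\<close> balls
  (\<open>measure_Union_balls_eq_if_dist_transform_eq\<close>), and, by inclusion-exclusion, the measure of
  every intersection of at most \<open>n + 1\<close> balls (\<open>measure_Inter_eq_if_measure_Union_eq\<close>).

  The dimension bound supplies families of balls in which all intersections of more than
  \<open>n + 1\<close> members are empty. For a finite subfamily, inclusion-exclusion involves only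
  intersections that are either empty or already known, so the measure of its union is determined,
  however many balls it has (\<open>measure_Union_eq_if_bounded_overlap\<close>). If \<open>K \<subseteq> U\<close> with \<open>K\<close> compact
  and \<open>U\<close> open, such a union fits between \<open>K\<close> and \<open>U\<close>: refine the cover \<open>{U, - K}\<close> of the space
  and keep finitely many of the balls that meet \<open>K\<close>. So \<open>\<mu> K \<le> \<nu> U\<close>, likewise \<open>\<nu> K \<le> \<mu> U\<close>, and the
  regularity of finite Borel measures on Polish spaces gives \<open>\<mu> = \<nu>\<close>.
\<close>

section \<open>Inclusion-exclusion for finite measures\<close>

lemma (in finite_measure) measure_Union_inclusion_exclusion:
  assumes "finite F" and "F \<subseteq> sets M"
  shows "measure M (\<Union>F) = (\<Sum>G | G \<subseteq> F \<and> G \<noteq> {}. (- 1) ^ (card G + 1) * measure M (\<Inter>G))"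
proof -
  interpret Incl_Excl "\<lambda>S. S \<in> sets M" "measure M"
    by standard (auto simp: disjnt_def intro: finite_measure_Union)
  show ?thesis
    using assms by (intro restricted) auto
qed

lemma measure_Union_eq_if_measure_Inter_eq:
  assumes "finite_measure M" and "finite_measure N" and "sets M = sets N"
    and "finite F" and "F \<subseteq> sets M"
    and "\<And>G. G \<subseteq> F \<Longrightarrow> G \<noteq> {} \<Longrightarrow> measure M (\<Inter>G) = measure N (\<Inter>G)"
  shows "measure M (\<Union>F) = measure N (\<Union>F)"
proof -
  have "measure M (\<Union>F) = (\<Sum>G | G \<subseteq> F \<and> G \<noteq> {}. (- 1) ^ (card G + 1) * measure M (\<Inter>G))"
    using assms(1,4,5) by (rule finite_measure.measure_Union_inclusion_exclusion)
  also have "\<dots> = (\<Sum>G | G \<subseteq> F \<and> G \<noteq> {}. (- 1) ^ (card G + 1) * measure N (\<Inter>G))"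
    using assms(6) by (intro sum.cong) auto
  also have "\<dots> = measure N (\<Union>F)"
    using assms(2-5) by (intro finite_measure.measure_Union_inclusion_exclusion[symmetric]) auto
  finally show ?thesis .
qed

text \<open>
  Inclusion-exclusion expresses \<open>measure M (\<Union>F)\<close> through the intersections of the nonempty
  subfamilies of \<open>F\<close>. All but the one of \<open>F\<close> itself are intersections of fewer sets, so the formula
  can be solved for \<open>measure M (\<Inter>F)\<close> recursively.
\<close>
lemma measure_Inter_eq_if_measure_Union_eq:
  assumes "finite_measure M" and "finite_measure N" and sets_eq: "sets M = sets N"
    and "finite F" and "F \<noteq> {}" and "F \<subseteq> sets M"
    and "\<And>G. G \<subseteq> F \<Longrightarrow> G \<noteq> {} \<Longrightarrow> measure M (\<Union>G) = measure N (\<Union>G)"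
  shows "measure M (\<Inter>F) = measure N (\<Inter>F)"
  using assms(4-7)
proof (induction F rule: finite_psubset_induct)
  case (psubset F)
  let ?P = "{G. G \<subseteq> F \<and> G \<noteq> {}}"
  have split: "measure L (\<Union>F) = (- 1) ^ (card F + 1) * measure L (\<Inter>F)
      + (\<Sum>G\<in>?P - {F}. (- 1) ^ (card G + 1) * measure L (\<Inter>G))"
    if "finite_measure L" and "sets L = sets M" for L
  proof -
    have "finite ?P" and "F \<in> ?P"
      using psubset by auto
    have "measure L (\<Union>F) = (\<Sum>G\<in>?P. (- 1) ^ (card G + 1) * measure L (\<Inter>G))"
      using that psubset by (intro finite_measure.measure_Union_inclusion_exclusion) auto
    also have "\<dots> = (- 1) ^ (card F + 1) * measure L (\<Inter>F)
        + (\<Sum>G\<in>?P - {F}. (- 1) ^ (card G + 1) * measure L (\<Inter>G))"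
      using \<open>finite ?P\<close> \<open>F \<in> ?P\<close> by (rule sum.remove)
    finally show ?thesis .
  qed
  have "measure M (\<Inter>G) = measure N (\<Inter>G)" if "G \<in> ?P - {F}" for G
  proof (rule psubset.IH)
    show "G \<subset> F" and "G \<noteq> {}" and "G \<subseteq> sets M"
      using that psubset.prems by auto
    show "measure M (\<Union>H) = measure N (\<Union>H)" if "H \<subseteq> G" and "H \<noteq> {}" for H
      using that \<open>G \<subset> F\<close> by (intro psubset.prems) auto
  qed
  then have "(\<Sum>G\<in>?P - {F}. (- 1) ^ (card G + 1) * measure M (\<Inter>G))
      = (\<Sum>G\<in>?P - {F}. (- 1) ^ (card G + 1) * measure N (\<Inter>G))"
    by (intro sum.cong) auto
  moreover have "measure M (\<Union>F) = measure N (\<Union>F)"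
    using psubset.prems by auto
  ultimately have "(- 1) ^ (card F + 1) * measure M (\<Inter>F) = (- 1) ^ (card F + 1) * measure N (\<Inter>F)"
    using split[OF assms(1) refl] split[OF assms(2) sets_eq[symmetric]] by linarith
  then show ?case
    by simp
qed

text \<open>
  The link between small unions and large ones: if all intersections of more than \<open>k\<close> members of
  \<open>F\<close> are empty, only intersections of at most \<open>k\<close> members contribute to the measure of
  \<open>\<Union>F\<close>, and these are determined by unions of at most \<open>k\<close> members.
\<close>
lemma measure_Union_eq_if_bounded_overlap:
  assumes "finite_measure M" and "finite_measure N" and "sets M = sets N"
    and "finite F" and "F \<subseteq> sets M"
    and overlap: "\<And>G. G \<subseteq> F \<Longrightarrow> k < card G \<Longrightarrow> \<Inter>G = {}"
    and small: "\<And>G. G \<subseteq> F \<Longrightarrow> G \<noteq> {} \<Longrightarrow> card G \<le> k \<Longrightarrow> measure M (\<Union>G) = measure N (\<Union>G)"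
  shows "measure M (\<Union>F) = measure N (\<Union>F)"
  using assms(1-5)
proof (rule measure_Union_eq_if_measure_Inter_eq)
  fix G
  assume G: "G \<subseteq> F" "G \<noteq> {}"
  then have "finite G"
    using \<open>finite F\<close> by (blast intro: finite_subset)
  show "measure M (\<Inter>G) = measure N (\<Inter>G)"
  proof (cases "card G \<le> k")
    case True
    show ?thesis
    proof (rule measure_Inter_eq_if_measure_Union_eq[OF assms(1-3) \<open>finite G\<close> \<open>G \<noteq> {}\<close>])
      show "G \<subseteq> sets M"
        using G assms(5) by blast
      show "measure M (\<Union>H) = measure N (\<Union>H)" if "H \<subseteq> G" and "H \<noteq> {}" for H
        using that G True card_mono[OF \<open>finite G\<close> \<open>H \<subseteq> G\<close>] by (intro small) auto
    qed
  next
    case False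
    then show ?thesis
      using overlap G by simp
  qed
qed

section \<open>Unions of few balls as sublevel sets\<close>

lemma UN_balls_eq_sublevel_scaled_dist_min:
  fixes a :: "nat \<Rightarrow> 'a::metric_space"
  assumes "\<And>i. i \<le> n \<Longrightarrow> 0 < r i" and "0 < t"
  shows "(\<Union>i\<le>n. ball (a i) (r i)) = {x. scaled_dist_min n (\<lambda>i. t / r i) a x < t}"
proof -
  have "t / r i * dist x (a i) < t \<longleftrightarrow> x \<in> ball (a i) (r i)" if "i \<le> n" for i x
    using assms(1)[OF that] assms(2) by (simp add: dist_commute field_simps)
  then show ?thesis
    by (auto simp: scaled_dist_min_def Min_less_iff)
qed

lemma UN_balls_as_sublevel_dist_min_fun:
  fixes a :: "nat \<Rightarrow> 'a::metric_space"
  assumes "\<And>i. i \<le> n \<Longrightarrow> 0 < r i"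
  obtains f t where "f \<in> dist_min_funs n" and "(\<Union>i\<le>n. ball (a i) (r i)) = {x. f x < t}"
proof
  \<comment> \<open>The smallest radius is the largest level that keeps all coefficients \<open>t / r i\<close> in \<open>[0,1]\<close>.\<close>
  define t where "t = Min (r ` {..n})"
  have "t \<in> r ` {..n}"
    unfolding t_def by (rule Min_in) auto
  then have "0 < t"
    using assms by auto
  moreover have "t \<le> r i" if "i \<le> n" for i
    using that by (simp add: t_def)
  ultimately show "scaled_dist_min n (\<lambda>i. t / r i) a \<in> dist_min_funs n"
    using assms by (fastforce simp: dist_min_funs_def less_imp_le)
  show "(\<Union>i\<le>n. ball (a i) (r i)) = {x. scaled_dist_min n (\<lambda>i. t / r i) a x < t}"
    using assms \<open>0 < t\<close> by (rule UN_balls_eq_sublevel_scaled_dist_min)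
qed

lemma measurable_dist_min_fun:
  assumes "f \<in> dist_min_funs n" and "sets M = sets borel"
  shows "f \<in> borel_measurable M"
proof -
  have "f \<in> borel_measurable borel"
    using assms(1)
    by (auto simp: dist_min_funs_def
        intro: borel_measurable_continuous_onI continuous_on_scaled_dist_min)
  then show ?thesis
    using measurable_cong_sets[OF assms(2) refl] by blast
qed

lemma measure_sublevel_eq_if_dist_transform_eq:
  fixes M N :: "'a::metric_space measure"
  assumes "sets M = sets borel" and "sets N = sets borel"
    and eq: "dist_transform n M = dist_transform n N" and f: "f \<in> dist_min_funs n"
  shows "measure M {x. f x < t} = measure N {x. f x < t}"
proof -
  have distr: "measure L {x. f x < t} = measure (distr L borel f) {..<t}"
    if "sets L = sets borel" for L :: "'a measure"
    using measurable_dist_min_fun[OF f that] sets_eq_imp_space_eq[OF that]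
    by (simp add: measure_distr vimage_def)
  have "distr M borel f = distr N borel f"
    using fun_cong[OF eq, of f] f by (simp add: dist_transform_def)
  then show ?thesis
    using distr assms(1,2) by simp
qed

text \<open>
  A family of fewer than \<open>n + 1\<close> balls is listed with repetitions, which is possible because the
  points of a tuple need not be distinct; only the empty family cannot be listed.
\<close>
lemma measure_Union_balls_eq_if_dist_transform_eq:
  fixes M N :: "'a::metric_space measure"
  assumes "sets M = sets borel" and "sets N = sets borel"
    and "dist_transform n M = dist_transform n N"
    and "finite G" and "G \<noteq> {}" and "card G \<le> n + 1"
    and balls: "\<And>B. B \<in> G \<Longrightarrow> \<exists>x r. r > 0 \<and> B = ball x r"
  shows "measure M (\<Union>G) = measure N (\<Union>G)"
proof -
  obtain h where h: "h ` {..n} = G"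
    using inj_on_iff_surj[OF \<open>G \<noteq> {}\<close>, of "{..n}"] inj_on_iff_card_le[OF \<open>finite G\<close>, of "{..n}"]
      \<open>card G \<le> n + 1\<close> by auto
  have "\<forall>i\<in>{..n}. \<exists>x r. r > 0 \<and> h i = ball x r"
    using balls h by blast
  then obtain a r where ar: "\<And>i. i \<le> n \<Longrightarrow> 0 < r i" "\<And>i. i \<le> n \<Longrightarrow> h i = ball (a i) (r i)"
    unfolding bchoice_iff by auto
  obtain f t where "f \<in> dist_min_funs n" and "(\<Union>i\<le>n. ball (a i) (r i)) = {x. f x < t}"
    using UN_balls_as_sublevel_dist_min_fun[of n r a] ar(1) by blast
  moreover have "\<Union>G = (\<Union>i\<le>n. ball (a i) (r i))"
    using h ar(2) by auto
  ultimately show ?thesis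
    using measure_sublevel_eq_if_dist_transform_eq assms(1-3) by metis
qed

section \<open>Approximation by unions of balls with bounded overlap\<close>

lemma ball_covering_dim_le_mono:
  assumes "ball_covering_dim_le S m" and "m \<le> n"
  shows "ball_covering_dim_le S n"
  unfolding ball_covering_dim_le_def
proof (intro allI impI)
  fix \<U> :: "'a set set"
  assume "(\<forall>U\<in>\<U>. open U) \<and> S \<subseteq> \<Union>\<U>"
  from assms(1)[unfolded ball_covering_dim_le_def, rule_format, OF this]
  obtain \<B> where "\<forall>B\<in>\<B>. \<exists>x r. r > 0 \<and> B = ball x r" and "S \<subseteq> \<Union>\<B>"
    and "\<forall>B\<in>\<B>. \<exists>U\<in>\<U>. B \<subseteq> U"
    and overlap: "\<forall>\<K>. \<K> \<subseteq> \<B> \<and> finite \<K> \<and> card \<K> > m + 1 \<longrightarrow> \<Inter>\<K> = {}"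
    by (elim exE conjE)
  moreover have "\<forall>\<K>. \<K> \<subseteq> \<B> \<and> finite \<K> \<and> card \<K> > n + 1 \<longrightarrow> \<Inter>\<K> = {}"
    using overlap \<open>m \<le> n\<close> by simp
  ultimately show "\<exists>\<B>. (\<forall>B\<in>\<B>. \<exists>x r. r > 0 \<and> B = ball x r) \<and> S \<subseteq> \<Union>\<B> \<and>
      (\<forall>B\<in>\<B>. \<exists>U\<in>\<U>. B \<subseteq> U) \<and>
      (\<forall>\<K>. \<K> \<subseteq> \<B> \<and> finite \<K> \<and> card \<K> > n + 1 \<longrightarrow> \<Inter>\<K> = {})"
    by (intro exI[of _ \<B>] conjI)
qed

lemma ball_covering_dim_le_if_metric_covering_dim_le:
  assumes "metric_covering_dim S \<le> enat n"
  shows "ball_covering_dim_le S n"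
proof -
  let ?D = "{m. ball_covering_dim_le S m}"
  have "enat ` ?D \<noteq> {}"
  proof
    assume "enat ` ?D = {}"
    then have "metric_covering_dim S = \<infinity>"
      unfolding metric_covering_dim_def Inf_enat_def by simp
    then show False
      using assms by simp
  qed
  then obtain k where "k \<in> enat ` ?D"
    by (auto simp only: ex_in_conv[symmetric])
  then have "metric_covering_dim S \<in> enat ` ?D"
    unfolding metric_covering_dim_def by (rule wellorder_InfI)
  then obtain m where m: "ball_covering_dim_le S m" and "m \<le> n"
    using assms by auto
  then show ?thesis
    by (rule ball_covering_dim_le_mono)
qed

text \<open>
  In a refinement of the cover \<open>{U, - K}\<close>, every ball that meets \<open>K\<close> fails to lie in \<open>- K\<close> and
  hence lies in \<open>U\<close>.
\<close>
lemma compact_subset_Union_balls_subset_open: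
  fixes K U :: "'a::metric_space set"
  assumes dim: "ball_covering_dim_le (UNIV :: 'a set) n"
    and "compact K" and "open U" and "K \<subseteq> U"
  obtains F where "finite F" and "\<And>B. B \<in> F \<Longrightarrow> \<exists>x r. r > 0 \<and> B = ball x r"
    and "K \<subseteq> \<Union>F" and "\<Union>F \<subseteq> U"
    and "\<And>G. G \<subseteq> F \<Longrightarrow> n + 1 < card G \<Longrightarrow> \<Inter>G = {}"
proof -
  have "(\<forall>V\<in>{U, - K}. open V) \<and> UNIV \<subseteq> \<Union>{U, - K}"
    using assms(2-4) by (auto intro: compact_imp_closed)
  from dim[unfolded ball_covering_dim_le_def, rule_format, OF this]
  obtain \<B> where balls: "\<forall>B\<in>\<B>. \<exists>x r. r > 0 \<and> B = ball x r"
    and cover: "UNIV \<subseteq> \<Union>\<B>" and refine: "\<forall>B\<in>\<B>. \<exists>V\<in>{U, - K}. B \<subseteq> V"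
    and overlap: "\<forall>\<K>. \<K> \<subseteq> \<B> \<and> finite \<K> \<and> card \<K> > n + 1 \<longrightarrow> \<Inter>\<K> = {}"
    by (elim exE conjE)
  have "K \<subseteq> \<Union>{B\<in>\<B>. B \<inter> K \<noteq> {}}"
    using cover by blast
  moreover have "open B" if "B \<in> {B\<in>\<B>. B \<inter> K \<noteq> {}}" for B
    using balls that by auto
  ultimately obtain F where F: "F \<subseteq> {B\<in>\<B>. B \<inter> K \<noteq> {}}" "finite F" "K \<subseteq> \<Union>F"
    by (rule compactE[OF \<open>compact K\<close>])
  show thesis
  proof (rule that[OF \<open>finite F\<close>])
    show "\<Union>F \<subseteq> U"
      using F(1) refine by blast
    show "\<Inter>G = {}" if "G \<subseteq> F" and "n + 1 < card G" for G
      using that F(1) overlap finite_subset[OF \<open>G \<subseteq> F\<close> \<open>finite F\<close>] by blast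
  qed (use F balls in auto)
qed

lemma emeasure_compact_le_open_if_dist_transform_eq:
  fixes M N :: "'a::metric_space measure"
  assumes "finite_measure M" and "finite_measure N"
    and M: "sets M = sets borel" and N: "sets N = sets borel"
    and eq: "dist_transform n M = dist_transform n N"
    and "ball_covering_dim_le (UNIV :: 'a set) n"
    and "compact K" and "open U" and "K \<subseteq> U"
  shows "emeasure M K \<le> emeasure N U"
proof -
  obtain F where F: "finite F" "\<And>B. B \<in> F \<Longrightarrow> \<exists>x r. r > 0 \<and> B = ball x r"
      "K \<subseteq> \<Union>F" "\<Union>F \<subseteq> U" "\<And>G. G \<subseteq> F \<Longrightarrow> n + 1 < card G \<Longrightarrow> \<Inter>G = {}"
    using compact_subset_Union_balls_subset_open assms(6-9) by metis
  have sets_F: "F \<subseteq> sets M"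
    using F(2) M by fastforce
  then have "\<Union>F \<in> sets M"
    using F(1) by auto
  have "measure M (\<Union>F) = measure N (\<Union>F)"
  proof (rule measure_Union_eq_if_bounded_overlap[where k = "n + 1"])
    show "measure M (\<Union>G) = measure N (\<Union>G)"
      if "G \<subseteq> F" and "G \<noteq> {}" and "card G \<le> n + 1" for G
      using that F(2) finite_subset[OF that(1) F(1)]
      by (intro measure_Union_balls_eq_if_dist_transform_eq[OF M N eq]) auto
  qed (use assms(1-4) F(1,5) sets_F in auto)
  then have "emeasure M (\<Union>F) = emeasure N (\<Union>F)"
    using assms(1,2) by (simp add: finite_measure.emeasure_eq_measure)
  moreover have "emeasure M K \<le> emeasure M (\<Union>F)"
    using F(3) \<open>\<Union>F \<in> sets M\<close> by (rule emeasure_mono)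
  moreover have "emeasure N (\<Union>F) \<le> emeasure N U"
    using F(4) \<open>open U\<close> N by (intro emeasure_mono) auto
  ultimately show ?thesis
    by simp
qed

section \<open>The transform determines the measure\<close>

lemma measure_eq_if_emeasure_compact_le_open:
  fixes M N :: "'a::polish_space measure"
  assumes "finite_measure M" and "finite_measure N"
    and M: "sets M = sets borel" and N: "sets N = sets borel"
    and MN: "\<And>K U. compact K \<Longrightarrow> open U \<Longrightarrow> K \<subseteq> U \<Longrightarrow> emeasure M K \<le> emeasure N U"
    and NM: "\<And>K U. compact K \<Longrightarrow> open U \<Longrightarrow> K \<subseteq> U \<Longrightarrow> emeasure N K \<le> emeasure M U"
  shows "M = N"
proof (rule measure_eqI)
  show "sets M = sets N"
    using M N by simp
  have fin: "emeasure M (space M) \<noteq> \<infinity>" "emeasure N (space N) \<noteq> \<infinity>"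
    using assms(1,2) by (auto simp: finite_measure.emeasure_eq_measure)
  have opens: "emeasure M U = emeasure N U" if "open U" for U
  proof (rule antisym)
    show "emeasure M U \<le> emeasure N U"
      using that MN by (subst inner_regular[OF M fin(1)]) (auto intro!: SUP_least)
    show "emeasure N U \<le> emeasure M U"
      using that NM by (subst inner_regular[OF N fin(2)]) (auto intro!: SUP_least)
  qed
  fix A
  assume "A \<in> sets M"
  then have "A \<in> sets borel"
    using M by simp
  then show "emeasure M A = emeasure N A"
    unfolding outer_regular[OF M fin(1) \<open>A \<in> sets borel\<close>] outer_regular[OF N fin(2) \<open>A \<in> sets borel\<close>]
    using opens by (intro INF_cong) auto
qed

theorem corollary12:
  fixes \<mu> \<nu> :: "'a::polish_space measure" and n :: nat
  assumes "metric_covering_dim (UNIV :: 'a set) \<le> enat n"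
    and "prob_space \<mu>" and "sets \<mu> = sets borel"
    and "prob_space \<nu>" and "sets \<nu> = sets borel"
  shows "dist_transform n \<mu> = dist_transform n \<nu> \<longleftrightarrow> \<mu> = \<nu>"
proof
  assume eq: "dist_transform n \<mu> = dist_transform n \<nu>"
  have fin: "finite_measure \<mu>" "finite_measure \<nu>"
    using assms(2,4) by (auto simp: prob_space_def)
  note dim = ball_covering_dim_le_if_metric_covering_dim_le[OF assms(1)]
  show "\<mu> = \<nu>"
    using fin assms(3,5)
    by (rule measure_eq_if_emeasure_compact_le_open)
      (use emeasure_compact_le_open_if_dist_transform_eq[OF fin assms(3,5) eq dim]
        emeasure_compact_le_open_if_dist_transform_eq[OF fin(2,1) assms(5,3) eq[symmetric] dim]
        in auto)
qed simp

end
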